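(* Let $K_n$ be the complete graph of order $n$. For every vertex $a$ of $K_n$, $d_d(a)=1$.
   Context: A dominating set of a finite simple graph $G$ is a set $D\subseteq V(G)$ such that every vertex in $V(G)\setminus D$ is adjacent to some vertex of $D$. A minimal dominating set is a dominating set that does not properly contain any other dominating set. The domination degree of a vertex $a$ is $d_d(a)=\min\{|D| : D \text{ is a minimal dominating set of } G \text{ with } a\in D\}$. Here $n\ge 1$. *)

theory Defs
  imports "Graph_Theory.Kuratowski"
begin

text \<open>
  Finite simple graphs are those satisfying \<^locale>\<open>graph\<close>: a simple undirected
  graph is a finite, loop-free, symmetric digraph without parallel arcs, so adjacency of
  \<open>u\<close> and \<open>v\<close> is \<open>u \<rightarrow>\<^bsub>G\<^esub> v\<close>.
\<close>

definition dominating_set :: "('a, 'b) pre_digraph \<Rightarrow> 'a set \<Rightarrow> bool" where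
  "dominating_set G D \<longleftrightarrow>
     D \<subseteq> verts G \<and> (\<forall>v \<in> verts G - D. \<exists>u \<in> D. v \<rightarrow>\<^bsub>G\<^esub> u)"

definition minimal_dominating_set :: "('a, 'b) pre_digraph \<Rightarrow> 'a set \<Rightarrow> bool" where
  "minimal_dominating_set G D \<longleftrightarrow>
     dominating_set G D \<and> \<not> (\<exists>D'. D' \<subset> D \<and> dominating_set G D')"

text \<open>
  For a vertex \<open>a\<close> of a finite simple graph the set below is finite and nonempty (extend
  \<open>{a}\<close> to a maximal independent set), so the value of \<^const>\<open>Min\<close> is the true minimum.
\<close>

definition domination_degree :: "('a, 'b) pre_digraph \<Rightarrow> 'a \<Rightarrow> nat" where
  "domination_degree G a = Min {card D | D. minimal_dominating_set G D \<and> a \<in> D}"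

end

theory Submission
  imports Defs
begin

text \<open>
  In a complete graph all other vertices are adjacent to \<open>a\<close>, so \<open>{a}\<close> already dominates.
  Hence the only minimal dominating set through \<open>a\<close> is \<open>{a}\<close> itself: a larger one would
  properly contain the dominating set \<open>{a}\<close>, while the only proper subset of \<open>{a}\<close> is empty
  and fails to dominate \<open>a\<close>. The minimum defining the domination degree is thus taken over
  the single value \<open>1\<close>.
\<close>

lemma dominating_set_singleton_complete:
  assumes "complete_digraph n G" and "a \<in> verts G"
  shows "dominating_set G {a}"
  using assms unfolding dominating_set_def complete_digraph_def by auto

lemma dominating_set_nonempty:
  assumes "dominating_set G D" and "verts G \<noteq> {}"
  shows "D \<noteq> {}"
  using assms unfolding dominating_set_def by auto

lemma minimal_dominating_set_complete_iff:
  assumes "complete_digraph n G" and "a \<in> verts G"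
  shows "minimal_dominating_set G D \<and> a \<in> D \<longleftrightarrow> D = {a}"
proof
  assume "minimal_dominating_set G D \<and> a \<in> D"
  then show "D = {a}"
    using dominating_set_singleton_complete[OF assms]
    unfolding minimal_dominating_set_def by blast
next
  assume "D = {a}"
  moreover have "\<not> dominating_set G D'" if "D' \<subset> {a}" for D'
    using dominating_set_nonempty assms(2) that by blast
  ultimately show "minimal_dominating_set G D \<and> a \<in> D"
    using dominating_set_singleton_complete[OF assms]
    unfolding minimal_dominating_set_def by blast
qed

theorem proposition3p9:
  fixes G :: "('a, 'b) pre_digraph" and n :: nat and a :: 'a
  assumes "n \<ge> 1"
    and "complete_digraph n G"
    and "a \<in> verts G"
  shows "domination_degree G a = 1"
  unfolding domination_degree_def
  by (simp add: minimal_dominating_set_complete_iff[OF assms(2,3)])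

end
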